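(* (Graded Skolem-Noether Theorem.) Let $G$ be a finite abelian group, $k$ a field, $V$ a nonzero finite dimensional $G$-graded $k$-vector space and $A=\mathrm{END}_k(V)$. Then every degree-preserving $k$-algebra automorphism $\gamma$ of $A$ is induced by a homogeneous linear automorphism of $V$: there exist $\sigma\in G$ and a linear automorphism $f$ of $V$, homogeneous of degree $\sigma$, such that $\gamma(a)=faf^{-1}$ for all $a\in A$.
   Context: For a finite dimensional $G$-graded space $V=\bigoplus_{g\in G}V_g$, $\mathrm{END}_k(V)$ is the algebra $\mathrm{End}_k(V)$ with the $G$-grading $\mathrm{END}_k(V)_\sigma=\{f\mid f(V_g)\subseteq V_{\sigma g}\ \forall g\in G\}$; elements of $\mathrm{END}_k(V)_\sigma$ are called homogeneous of degree $\sigma$. Such graded algebras are exactly, up to isomorphism, the matrix algebras with a good grading (a grading for which all the matrix units are homogeneous). *)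

theory Defs
  imports Complex_Main
begin

text \<open>
  The finite abelian grading group is a type of class \<open>{ab_group_add, finite}\<close>, so it is
  written additively: the degree \<open>\<sigma>g\<close> becomes \<open>\<sigma> + g\<close>. The vector space is the type
  \<open>'v\<close> together with an explicit scalar multiplication, as in the library's locale
  \<open>vector_space\<close>.
\<close>

text \<open>Since the group is finite, decompositions need no finite-support condition.\<close>

locale graded_vector_space = vector_space scale
  for scale :: "'k::field \<Rightarrow> 'v::ab_group_add \<Rightarrow> 'v" +
  fixes V :: "'g::{ab_group_add, finite} \<Rightarrow> 'v set"
  assumes subspace_component: "\<And>g. subspace (V g)"
    and direct_sum: "\<And>v. \<exists>!x. (\<forall>g. x g \<in> V g) \<and> v = (\<Sum>g\<in>UNIV. x g)"

definition End_alg :: "('k::field \<Rightarrow> 'v::ab_group_add \<Rightarrow> 'v) \<Rightarrow> ('v \<Rightarrow> 'v) set" where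
  "End_alg scale = {f. Vector_Spaces.linear scale scale f}"

definition END_comp ::
  "('k::field \<Rightarrow> 'v::ab_group_add \<Rightarrow> 'v) \<Rightarrow> ('g::ab_group_add \<Rightarrow> 'v set) \<Rightarrow> 'g \<Rightarrow> ('v \<Rightarrow> 'v) set"
  where
  "END_comp scale V \<sigma> = {f \<in> End_alg scale. \<forall>g. f ` V g \<subseteq> V (\<sigma> + g)}"

text \<open>
  The algebra operations of \<open>End\<^sub>k(V)\<close> are pointwise addition, pointwise scalar
  multiplication and composition. Values of \<open>\<gamma>\<close> outside \<open>End_alg scale\<close> are irrelevant.
\<close>

definition End_alg_automorphism ::
  "('k::field \<Rightarrow> 'v::ab_group_add \<Rightarrow> 'v) \<Rightarrow> (('v \<Rightarrow> 'v) \<Rightarrow> ('v \<Rightarrow> 'v)) \<Rightarrow> bool" where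
  "End_alg_automorphism scale \<gamma> \<longleftrightarrow>
     bij_betw \<gamma> (End_alg scale) (End_alg scale) \<and>
     (\<forall>a\<in>End_alg scale. \<forall>b\<in>End_alg scale. \<gamma> (\<lambda>v. a v + b v) = (\<lambda>v. \<gamma> a v + \<gamma> b v)) \<and>
     (\<forall>c. \<forall>a\<in>End_alg scale. \<gamma> (\<lambda>v. scale c (a v)) = (\<lambda>v. scale c (\<gamma> a v))) \<and>
     (\<forall>a\<in>End_alg scale. \<forall>b\<in>End_alg scale. \<gamma> (a \<circ> b) = \<gamma> a \<circ> \<gamma> b) \<and>
     \<gamma> id = id"

definition degree_preserving ::
  "('k::field \<Rightarrow> 'v::ab_group_add \<Rightarrow> 'v) \<Rightarrow> ('g::ab_group_add \<Rightarrow> 'v set)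
     \<Rightarrow> (('v \<Rightarrow> 'v) \<Rightarrow> ('v \<Rightarrow> 'v)) \<Rightarrow> bool" where
  "degree_preserving scale V \<gamma> \<longleftrightarrow> (\<forall>\<sigma>. \<gamma> ` END_comp scale V \<sigma> \<subseteq> END_comp scale V \<sigma>)"

end

theory Submission imports Defs begin

text \<open>
  Any automorphism \<open>\<gamma>\<close> of the endomorphism algebra is implemented by evaluating the images of
  rank-one operators. Fix a vector \<open>e\<close>, a linear functional \<open>\<phi>\<close> with \<open>\<phi> e = 1\<close>, and write
  \<open>v \<otimes> \<phi>\<close> for the operator \<open>w \<mapsto> \<phi>(w) v\<close>. Since \<open>a \<circ> (v \<otimes> \<phi>) = a v \<otimes> \<phi>\<close>, the operators
  \<open>v \<otimes> \<phi>\<close> form a left ideal that is a copy of the space \<open>V\<close> itself, and for every vector \<open>u\<close> the map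
  \<open>f v = \<gamma> (v \<otimes> \<phi>) u\<close> satisfies \<open>f (a v) = \<gamma> a (f v)\<close>. The operator \<open>e \<otimes> \<phi>\<close> is nonzero,
  hence so is its image under \<open>\<gamma>\<close>, and \<open>u\<close> can be chosen such that \<open>f e = \<gamma> (e \<otimes> \<phi>) u \<noteq> 0\<close>.
  As \<open>End(V)\<close> acts transitively on nonzero vectors, such an \<open>f\<close> is bijective, and
  the intertwining relation reads \<open>\<gamma> a = f a f\<^sup>-\<^sup>1\<close>.

  The grading enters only through the choices of \<open>e\<close>, \<open>\<phi>\<close> and \<open>u\<close>. If \<open>e\<close> has degree \<open>g\<close>
  and \<open>\<phi>\<close> kills all other components, then \<open>v \<otimes> \<phi>\<close> is homogeneous of degree \<open>h - g\<close> whenever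
  \<open>v\<close> has degree \<open>h\<close>, and so is its image under \<open>\<gamma>\<close>. An operator that vanishes on all homogeneous vectors
  is zero, so \<open>u\<close> can be chosen homogeneous, say of degree \<open>g'\<close>, and then \<open>f\<close> is homogeneous of
  degree \<open>g' - g\<close>.
\<close>

definition rank_one :: "('k \<Rightarrow> 'v \<Rightarrow> 'v) \<Rightarrow> ('v \<Rightarrow> 'k) \<Rightarrow> 'v \<Rightarrow> 'v \<Rightarrow> 'v" where
  "rank_one scale \<phi> v = (\<lambda>w. scale (\<phi> w) v)"

context vector_space
begin

lemma ex_functional_eq_1:
  assumes "v \<noteq> 0"
  shows "\<exists>\<psi>. Vector_Spaces.linear scale (*) \<psi> \<and> \<psi> v = 1"
proof -
  interpret vs: vector_space_pair scale "(*) :: 'a \<Rightarrow> 'a \<Rightarrow> 'a"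
    by unfold_locales (auto simp: algebra_simps)
  have "independent {v}"
    using assms by simp
  from vs.linear_independent_extend[OF this, of "\<lambda>_. 1"] show ?thesis
    by auto
qed

lemma End_alg_iff:
  "f \<in> End_alg scale \<longleftrightarrow> (\<forall>x y. f (x + y) = f x + f y) \<and> (\<forall>c x. f (scale c x) = scale c (f x))"
  using vector_space_axioms by (simp add: End_alg_def Vector_Spaces.linear_iff)

lemma rank_one_in_End_alg:
  assumes "Vector_Spaces.linear scale (*) \<phi>"
  shows "rank_one scale \<phi> v \<in> End_alg scale"
proof -
  interpret \<phi>: Vector_Spaces.linear scale "(*)" \<phi>
    by (fact assms)
  show ?thesis
    by (simp add: End_alg_iff rank_one_def \<phi>.add \<phi>.scale scale_left_distrib)
qed

lemma comp_rank_one: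
  assumes "a \<in> End_alg scale"
  shows "a \<circ> rank_one scale \<phi> v = rank_one scale \<phi> (a v)"
  using assms by (auto simp: End_alg_iff rank_one_def)

text \<open>This is the simplicity of \<open>V\<close> as an \<open>End(V)\<close>-module, witnessed by a rank-one operator.\<close>

lemma ex_End_alg_maps_to:
  assumes "v \<noteq> 0"
  shows "\<exists>a\<in>End_alg scale. a v = w"
proof -
  obtain \<psi> where "Vector_Spaces.linear scale (*) \<psi>" "\<psi> v = 1"
    using ex_functional_eq_1[OF assms] by blast
  then show ?thesis
    by (intro bexI[of _ "rank_one scale \<psi> w"] rank_one_in_End_alg) (simp_all add: rank_one_def)
qed

text \<open>
  Schur's lemma for the simple module \<open>V\<close> and its twist by \<open>\<gamma>\<close>, in the elementary form that
  only uses transitivity on nonzero vectors.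
\<close>

lemma bij_intertwiner:
  assumes f: "f \<in> End_alg scale"
    and surj: "\<gamma> ` End_alg scale = End_alg scale"
    and inter: "\<And>a v. a \<in> End_alg scale \<Longrightarrow> f (a v) = \<gamma> a (f v)"
    and nz: "f e \<noteq> 0"
  shows "bij f"
proof (rule bijI)
  have zero: "a 0 = 0" if "a \<in> End_alg scale" for a
    using that unfolding End_alg_iff by (metis add_cancel_right_right)
  have minus: "f (x - y) = f x - f y" for x y
    using f unfolding End_alg_iff by (metis add_diff_cancel diff_add_cancel)
  have "v = 0" if "f v = 0" for v
  proof (rule ccontr)
    assume "v \<noteq> 0"
    then obtain a where a: "a \<in> End_alg scale" "a v = e"
      using ex_End_alg_maps_to by blast
    then have "f e = \<gamma> a 0"
      using inter that by metis
    also have "\<dots> = 0"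
      using a surj by (intro zero) blast
    finally show False
      using nz by simp
  qed
  then show "inj f"
    by (metis injI minus right_minus_eq)
  have "w \<in> range f" for w
  proof -
    obtain b where "b \<in> End_alg scale" "b (f e) = w"
      using ex_End_alg_maps_to[OF nz] by blast
    then obtain a where "a \<in> End_alg scale" "\<gamma> a (f e) = w"
      using surj by (metis imageE)
    then show ?thesis
      using inter by (metis rangeI)
  qed
  then show "surj f"
    by auto
qed

end

context graded_vector_space
begin

lemma zero_in_component: "0 \<in> V g"
  using subspace_component subspace_0 by blast

text \<open>
  Supplies both homogeneous vectors of the construction: with \<open>a = id\<close> the vector \<open>e\<close>, and with
  \<open>a = \<gamma> (e \<otimes> \<phi>)\<close> the vector \<open>u\<close>.
\<close>

lemma ex_homogeneous_nonzero:
  assumes a: "a \<in> End_alg scale" and nz: "a v \<noteq> 0"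
  shows "\<exists>g. \<exists>u\<in>V g. a u \<noteq> 0"
proof (rule ccontr)
  assume "\<not> ?thesis"
  then have kill: "a u = 0" if "u \<in> V g" for g u
    using that by blast
  interpret a: Vector_Spaces.linear scale scale a
    using a by (simp add: End_alg_def)
  obtain x where x: "\<forall>g. x g \<in> V g" "v = (\<Sum>g\<in>UNIV. x g)"
    using direct_sum by blast
  then have "a v = (\<Sum>g\<in>UNIV. a (x g))"
    by (simp add: a.sum)
  also have "\<dots> = 0"
    using x(1) kill by (intro sum.neutral) blast
  finally show False
    using nz by simp
qed

definition component :: "'v \<Rightarrow> 'g \<Rightarrow> 'v" where
  "component v = (THE x. (\<forall>g. x g \<in> V g) \<and> v = (\<Sum>g\<in>UNIV. x g))"

lemma component_in: "component v g \<in> V g"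
  and sum_component: "(\<Sum>g\<in>UNIV. component v g) = v"
  using theI'[OF direct_sum[of v]] by (auto simp: component_def)

lemma component_eqI:
  assumes "\<And>g. x g \<in> V g" "v = (\<Sum>g\<in>UNIV. x g)"
  shows "component v = x"
  using assms component_in sum_component direct_sum[of v] by metis

lemma component_add: "component (v + w) = (\<lambda>g. component v g + component w g)"
  by (rule component_eqI)
    (simp_all add: sum.distrib sum_component subspace_add[OF subspace_component] component_in)

lemma component_scale: "component (scale c v) = (\<lambda>g. scale c (component v g))"
  by (rule component_eqI)
    (simp_all add: scale_sum_right[symmetric] sum_component
      subspace_scale[OF subspace_component] component_in)

lemma component_homogeneous:
  assumes "v \<in> V h"
  shows "component v = (\<lambda>g. if g = h then v else 0)"
  using assms by (intro component_eqI) (simp_all add: zero_in_component)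

text \<open>
  Composing an arbitrary functional with the projection onto \<open>V g\<close> makes it vanish on the other
  components; this is why the projections are shown to be linear above.
\<close>

lemma ex_homogeneous_functional:
  assumes "e \<in> V g" "e \<noteq> 0"
  shows "\<exists>\<phi>. Vector_Spaces.linear scale (*) \<phi> \<and> \<phi> e = 1 \<and> (\<forall>h w. w \<in> V h \<longrightarrow> h \<noteq> g \<longrightarrow> \<phi> w = 0)"
proof -
  have field_vs: "vector_space ((*) :: 'k \<Rightarrow> 'k \<Rightarrow> 'k)"
    by unfold_locales (auto simp: algebra_simps)
  obtain \<psi> where \<psi>: "Vector_Spaces.linear scale (*) \<psi>" "\<psi> e = 1"
    using ex_functional_eq_1[OF assms(2)] by blast
  interpret \<psi>: Vector_Spaces.linear scale "(*)" \<psi>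
    by (fact \<psi>(1))
  have "Vector_Spaces.linear scale (*) (\<lambda>w. \<psi> (component w g))"
    using vector_space_axioms field_vs
    by (simp add: Vector_Spaces.linear_iff component_add component_scale \<psi>.add \<psi>.scale)
  moreover have "\<psi> (component e g) = 1"
    using assms(1) \<psi>(2) by (simp add: component_homogeneous)
  moreover have "\<psi> (component w g) = 0" if "w \<in> V h" "h \<noteq> g" for h w
    using that by (simp add: component_homogeneous \<psi>.zero)
  ultimately show ?thesis
    by blast
qed

lemma rank_one_in_END_comp:
  assumes "Vector_Spaces.linear scale (*) \<phi>"
    and kill: "\<forall>h w. w \<in> V h \<longrightarrow> h \<noteq> g \<longrightarrow> \<phi> w = 0"
    and v: "v \<in> V h"
  shows "rank_one scale \<phi> v \<in> END_comp scale V (h - g)"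
proof -
  have "rank_one scale \<phi> v w \<in> V (h - g + j)" if "w \<in> V j" for j w
  proof (cases "j = g")
    case True
    then show ?thesis
      using subspace_scale[OF subspace_component v] by (simp add: rank_one_def)
  next
    case False
    then have "\<phi> w = 0"
      using kill that by blast
    then show ?thesis
      by (simp add: rank_one_def zero_in_component)
  qed
  then show ?thesis
    using rank_one_in_End_alg[OF assms(1)] by (auto simp: END_comp_def)
qed

end

theorem mainTheorem7:
  fixes scale :: "'k::field \<Rightarrow> 'v::ab_group_add \<Rightarrow> 'v"
    and Basis :: "'v set"
    and V :: "'g::{ab_group_add, finite} \<Rightarrow> 'v set"
    and \<gamma> :: "('v \<Rightarrow> 'v) \<Rightarrow> ('v \<Rightarrow> 'v)"
  assumes "finite_dimensional_vector_space scale Basis"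
    and "\<exists>v::'v. v \<noteq> 0"
    and "graded_vector_space scale V"
    and "End_alg_automorphism scale \<gamma>"
    and "degree_preserving scale V \<gamma>"
  shows "\<exists>\<sigma> f. f \<in> END_comp scale V \<sigma> \<and> bij f \<and>
           (\<forall>a \<in> End_alg scale. \<gamma> a = f \<circ> a \<circ> inv f)"
proof -
  interpret graded_vector_space scale V
    by (fact assms(3))
  let ?E = "End_alg scale"
  have bij: "bij_betw \<gamma> ?E ?E"
    and add: "a \<in> ?E \<Longrightarrow> b \<in> ?E \<Longrightarrow> \<gamma> (\<lambda>v. a v + b v) = (\<lambda>v. \<gamma> a v + \<gamma> b v)"
    and scal: "a \<in> ?E \<Longrightarrow> \<gamma> (\<lambda>v. scale c (a v)) = (\<lambda>v. scale c (\<gamma> a v))"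
    and comp: "a \<in> ?E \<Longrightarrow> b \<in> ?E \<Longrightarrow> \<gamma> (a \<circ> b) = \<gamma> a \<circ> \<gamma> b" for a b c
    using assms(4) by (simp_all add: End_alg_automorphism_def)
  have \<gamma>E: "\<gamma> a \<in> ?E" if "a \<in> ?E" for a
    using bij that by (auto simp: bij_betw_def)
  have deg: "\<gamma> a w \<in> V (\<sigma> + h)" if "a \<in> END_comp scale V \<sigma>" "w \<in> V h" for a \<sigma> w h
    using assms(5) that unfolding degree_preserving_def END_comp_def by blast

  have "id \<in> ?E"
    by (simp add: End_alg_iff)
  then obtain g e where e: "e \<in> V g" "e \<noteq> 0"
    using assms(2) ex_homogeneous_nonzero by (metis id_apply)
  then obtain \<phi> where \<phi>: "Vector_Spaces.linear scale (*) \<phi>" "\<phi> e = 1"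
      "\<forall>h w. w \<in> V h \<longrightarrow> h \<noteq> g \<longrightarrow> \<phi> w = 0"
    using ex_homogeneous_functional by blast
  note RE = rank_one_in_End_alg[OF \<phi>(1)]
  let ?p = "rank_one scale \<phi> e"
  have zeroE: "(\<lambda>v. 0) \<in> ?E"
    by (simp add: End_alg_iff)
  have "\<gamma> (\<lambda>v. 0) = (\<lambda>v. 0)"
    using scal[OF zeroE, of 0] by simp
  moreover have "?p \<noteq> (\<lambda>v. 0)"
    using e \<phi>(2) by (metis rank_one_def scale_one)
  ultimately have "\<gamma> ?p \<noteq> (\<lambda>v. 0)"
    using bij RE zeroE unfolding bij_betw_def inj_on_def by metis
  then obtain g' u where u: "u \<in> V g'" "\<gamma> ?p u \<noteq> 0"
    using ex_homogeneous_nonzero[OF \<gamma>E[OF RE]] by blast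
  define f where "f v = \<gamma> (rank_one scale \<phi> v) u" for v

  \<comment> \<open>\<open>\<gamma>\<close> carries the left ideal of all \<open>v \<otimes> \<phi>\<close> to a left ideal, and evaluation at \<open>u\<close> is a
    module map on that; \<open>f\<close> is the composite.\<close>
  have inter: "f (a v) = \<gamma> a (f v)" if "a \<in> ?E" for a v
    using comp[OF that RE] by (simp add: f_def comp_rank_one[OF that, symmetric])
  have fE: "f \<in> ?E"
    using add[OF RE RE] scal[OF RE]
    by (simp add: End_alg_iff f_def rank_one_def scale_right_distrib fun_eq_iff mult.commute)
  have "f e \<noteq> 0"
    using u(2) by (simp add: f_def)
  then have bijf: "bij f"
    using bij by (intro bij_intertwiner[OF fE _ inter]) (simp_all add: bij_betw_def)
  have "f v \<in> V (g' - g + h)" if "v \<in> V h" for v h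
    using deg[OF rank_one_in_END_comp[OF \<phi>(1,3) that] u(1)] by (simp add: f_def algebra_simps)
  then have "f \<in> END_comp scale V (g' - g)"
    using fE by (auto simp: END_comp_def)
  moreover have "\<gamma> a = f \<circ> a \<circ> inv f" if "a \<in> ?E" for a
    using inter[OF that] bijf by (simp add: fun_eq_iff bij_is_surj surj_f_inv_f)
  ultimately show ?thesis
    using bijf by blast
qed

end
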